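(* Let $R=\sum_{\alpha\in L}b_\alpha X^\alpha$ be the counting function of a (nonempty) fraction $\mathcal F$, possibly with replicates, of the complex coded full factorial design $\mathcal D$. (1) For $\alpha\in L$, the term $X^\alpha$ is centered on $\mathcal F$ if, and only if, $b_\alpha=b_{[-\alpha]}=0$. (2) For $\alpha,\beta\in L$, the terms $X^\alpha$ and $X^\beta$ are orthogonal on $\mathcal F$ if, and only if, $b_{[\alpha-\beta]}=0$. (3) If $X^\alpha$ is centered on $\mathcal F$ then, for each $\beta,\gamma\in L$ such that $\alpha=[\beta-\gamma]$ or $\alpha=[\gamma-\beta]$, $X^\beta$ is orthogonal to $X^\gamma$ on $\mathcal F$. (4) The fraction $\mathcal F$ is self-conjugate, that is, $R(\zeta)=R(\overline\zeta)$ for every $\zeta\in\mathcal D$, if, and only if, the coefficients $b_\alpha$ are real for all $\alpha\in L$.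
   Context: Let $m\ge 1$ and let $n_1,\dots,n_m$ be positive integers. For a positive integer $n$, $\Omega_n\subset\mathbb C$ is the set of $n$-th roots of unity. The full factorial design is $\mathcal D=\Omega_{n_1}\times\cdots\times\Omega_{n_m}$ and the exponent set is $L=\mathbb Z_{n_1}\times\cdots\times\mathbb Z_{n_m}$, with elements $\alpha=(\alpha_1,\dots,\alpha_m)$, $0\le\alpha_j\le n_j-1$. For $\alpha,\beta\in L$, $[\alpha-\beta]\in L$ is the $m$-tuple with $j$-th entry $\alpha_j-\beta_j$ reduced mod $n_j$, and $[-\alpha]=[0-\alpha]$. For $\alpha\in L$, $X^\alpha:\mathcal D\to\mathbb C$ is $X^\alpha(\zeta_1,\dots,\zeta_m)=\zeta_1^{\alpha_1}\cdots\zeta_m^{\alpha_m}$. Every function $f:\mathcal D\to\mathbb C$ can be written uniquely as $\sum_{\alpha\in L}\theta_\alpha X^\alpha$ with $\theta_\alpha\in\mathbb C$. For $\zeta\in\mathcal D$, $\overline\zeta$ is the componentwise complex conjugate. A fraction $\mathcal F$ is a multi-subset of $\mathcal D$ (points may be repeated). Its counting function $R$ gives, for each $\zeta\in\mathcal D$, the number of appearances of $\zeta$ in $\mathcal F$, and $b_\alpha$ are the coefficients of $R$ in the monomial basis. Put $\#\mathcal F=\sum_{\zeta\in\mathcal D}R(\zeta)$. For $f:\mathcal D\to\mathbb C$, the mean value on $\mathcal F$ is $E_{\mathcal F}(f)=\frac1{\#\mathcal F}\sum_{\zeta\in\mathcal F}f(\zeta)=\frac1{\#\mathcal F}\sum_{\zeta\in\mathcal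 D}R(\zeta)f(\zeta)$. The function $f$ is centered on $\mathcal F$ if $E_{\mathcal F}(f)=0$; two functions $f,g$ are orthogonal on $\mathcal F$ if $E_{\mathcal F}(f\,\overline g)=0$. *)

theory Defs
  imports Complex_Main "HOL-Library.FuncSet" "HOL-Library.Multiset"
begin

text \<open>
  Points and exponents are extensional functions on the index set \<open>{1..m}\<close>; the tuple
  \<open>n\<^sub>1, \<dots>, n\<^sub>m\<close> is given by the values on \<open>{1..m}\<close> of a function \<open>n\<close>.
  Exponents are the least nonnegative representatives of the residue classes.
\<close>

definition roots_of_unity :: "nat \<Rightarrow> complex set" where
  "roots_of_unity n = {z. z ^ n = 1}"

definition full_design :: "nat \<Rightarrow> (nat \<Rightarrow> nat) \<Rightarrow> (nat \<Rightarrow> complex) set" where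
  "full_design m n = (\<Pi>\<^sub>E j\<in>{1..m}. roots_of_unity (n j))"

definition exponents :: "nat \<Rightarrow> (nat \<Rightarrow> nat) \<Rightarrow> (nat \<Rightarrow> nat) set" where
  "exponents m n = (\<Pi>\<^sub>E j\<in>{1..m}. {0..<n j})"

definition diff_mod ::
    "nat \<Rightarrow> (nat \<Rightarrow> nat) \<Rightarrow> (nat \<Rightarrow> nat) \<Rightarrow> (nat \<Rightarrow> nat) \<Rightarrow> (nat \<Rightarrow> nat)" where
  "diff_mod m n \<alpha> \<beta> = (\<lambda>j\<in>{1..m}. nat ((int (\<alpha> j) - int (\<beta> j)) mod int (n j)))"

definition neg_mod :: "nat \<Rightarrow> (nat \<Rightarrow> nat) \<Rightarrow> (nat \<Rightarrow> nat) \<Rightarrow> (nat \<Rightarrow> nat)" where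
  "neg_mod m n \<alpha> = diff_mod m n (\<lambda>j\<in>{1..m}. 0) \<alpha>"

definition monomial :: "nat \<Rightarrow> (nat \<Rightarrow> nat) \<Rightarrow> (nat \<Rightarrow> complex) \<Rightarrow> complex" where
  "monomial m \<alpha> \<zeta> = (\<Prod>j\<in>{1..m}. \<zeta> j ^ \<alpha> j)"

definition conj_point :: "nat \<Rightarrow> (nat \<Rightarrow> complex) \<Rightarrow> (nat \<Rightarrow> complex)" where
  "conj_point m \<zeta> = (\<lambda>j\<in>{1..m}. cnj (\<zeta> j))"

text \<open>
  A fraction is a multiset of design points; its counting function is \<^const>\<open>count\<close>.
\<close>

definition is_fraction :: "nat \<Rightarrow> (nat \<Rightarrow> nat) \<Rightarrow> (nat \<Rightarrow> complex) multiset \<Rightarrow> bool" where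
  "is_fraction m n F \<longleftrightarrow> set_mset F \<subseteq> full_design m n"

definition mean_value :: "'a multiset \<Rightarrow> ('a \<Rightarrow> complex) \<Rightarrow> complex" where
  "mean_value F f = (\<Sum>\<zeta>\<in>#F. f \<zeta>) / of_nat (size F)"

definition centered_on :: "'a multiset \<Rightarrow> ('a \<Rightarrow> complex) \<Rightarrow> bool" where
  "centered_on F f \<longleftrightarrow> mean_value F f = 0"

definition orthogonal_on ::
    "'a multiset \<Rightarrow> ('a \<Rightarrow> complex) \<Rightarrow> ('a \<Rightarrow> complex) \<Rightarrow> bool" where
  "orthogonal_on F f g \<longleftrightarrow> mean_value F (\<lambda>\<zeta>. f \<zeta> * cnj (g \<zeta>)) = 0"

definition self_conjugate ::
    "nat \<Rightarrow> (nat \<Rightarrow> nat) \<Rightarrow> (nat \<Rightarrow> complex) multiset \<Rightarrow> bool" where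
  "self_conjugate m n F \<longleftrightarrow>
     (\<forall>\<zeta>\<in>full_design m n. count F \<zeta> = count F (conj_point m \<zeta>))"

text \<open>
  The values of \<open>\<theta>\<close> outside \<^const>\<open>exponents\<close> are irrelevant; on it they are
  determined by \<open>f\<close>, since the monomials form a basis of the functions on the design.
\<close>

definition monomial_coefficients ::
    "nat \<Rightarrow> (nat \<Rightarrow> nat) \<Rightarrow> ((nat \<Rightarrow> complex) \<Rightarrow> complex) \<Rightarrow> ((nat \<Rightarrow> nat) \<Rightarrow> complex) \<Rightarrow> bool" where
  "monomial_coefficients m n f \<theta> \<longleftrightarrow>
     (\<forall>\<zeta>\<in>full_design m n. f \<zeta> = (\<Sum>\<alpha>\<in>exponents m n. \<theta> \<alpha> * monomial m \<alpha> \<zeta>))"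

end

theory Submission
  imports Defs
begin

text \<open>
  The monomials are the characters of the finite abelian group \<^term>\<open>full_design m n\<close>, and the
  theorem is Fourier inversion on that group. The characters are orthogonal
  (\<open>sum_monomial_mult_cnj\<close>): the sum over a product set is a product of sums over roots of
  unity, and each factor is invariant under multiplication by a number that differs from 1 unless
  the two exponents agree. Hence \<open>b \<alpha>\<close> is, up to the number of points of the design, the sum of
  the counting function against the conjugate of \<open>X\<^sup>\<alpha>\<close>. Counting functions are real, so this
  says that the mean of \<open>X\<^sup>\<alpha>\<close> on the fraction is a nonzero multiple of the conjugate of
  \<open>b \<alpha>\<close> (\<open>mean_value_monomial\<close>).

  Conjugation inverts roots of unity, so on the design the product of \<open>X\<^sup>\<alpha>\<close> with the conjugate of
  \<open>X\<^sup>\<beta>\<close> is \<open>X\<close> to the power \<open>[\<alpha> - \<beta>]\<close>. In this way every orthogonality relation becomes a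
  centering relation, and the statements about centering and orthogonality follow from the formula
  for the mean. The case \<open>[\<gamma> - \<beta>]\<close> reduces to \<open>[\<beta> - \<gamma>]\<close> because orthogonality is symmetric.

  For the last statement, precomposition with conjugation of points acts on monomials as
  conjugation of values. It therefore turns the Fourier formula for \<open>b \<alpha>\<close> into its conjugate
  when the fraction is self-conjugate, and the expansion of the counting function into its
  conjugate when the coefficients are real.
\<close>

section \<open>Roots of unity\<close>

lemma finite_roots_of_unity: "n \<ge> 1 \<Longrightarrow> finite (roots_of_unity n)"
  unfolding roots_of_unity_def by (rule finite_roots_unity) simp

lemma root_of_unity_mult_cnj:
  assumes "z \<in> roots_of_unity n" and "n \<ge> 1"
  shows "z * cnj z = 1"
proof -
  have "norm z = 1"
    using assms power_eq_1_iff[of z n] by (auto simp: roots_of_unity_def)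
  then show ?thesis by (simp flip: complex_norm_square)
qed

lemma roots_of_unity_mult:
  "w \<in> roots_of_unity n \<Longrightarrow> z \<in> roots_of_unity n \<Longrightarrow> w * z \<in> roots_of_unity n"
  by (simp add: roots_of_unity_def power_mult_distrib)

lemma roots_of_unity_cnj: "z \<in> roots_of_unity n \<Longrightarrow> cnj z \<in> roots_of_unity n"
  by (simp add: roots_of_unity_def flip: complex_cnj_power)

text \<open>
  A primitive root separates the exponents, because its powers enumerate all \<open>n\<close> roots of unity
  without repetition.
\<close>

lemma ex_root_of_unity_separating:
  assumes "a < n" "b < n" "a \<noteq> b"
  obtains w where "w \<in> roots_of_unity n" "w ^ a \<noteq> w ^ b"
proof
  let ?w = "cis (2 * pi / real n)"
  have n: "n > 0" using assms by simp
  have pow: "?w ^ k = cis (2 * pi * real k / real n)" for k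
    by (simp add: DeMoivre mult_ac)
  show "?w \<in> roots_of_unity n"
    using n by (simp add: roots_of_unity_def pow)
  show "?w ^ a \<noteq> ?w ^ b"
    using bij_betw_roots_unity[OF n] assms unfolding pow bij_betw_def inj_on_def by blast
qed

lemma sum_roots_of_unity_power_mult_cnj:
  assumes "a < n" "b < n"
  shows "(\<Sum>z\<in>roots_of_unity n. z ^ a * cnj (z ^ b)) = (if a = b then of_nat n else 0)"
proof (cases "a = b")
  case True
  have "(\<Sum>z\<in>roots_of_unity n. z ^ a * cnj (z ^ b)) = (\<Sum>z\<in>roots_of_unity n. 1)"
    using assms by (intro sum.cong refl)
      (simp add: True root_of_unity_mult_cnj[of _ n] flip: power_mult_distrib)
  also have "\<dots> = of_nat n"
    using assms card_roots_unity_eq[of n] by (simp add: roots_of_unity_def)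
  finally show ?thesis using True by simp
next
  case False
  obtain w where w: "w \<in> roots_of_unity n" "w ^ a \<noteq> w ^ b"
    using ex_root_of_unity_separating[OF assms False] .
  have ww: "w * cnj w = 1"
    using root_of_unity_mult_cnj[OF w(1)] assms by simp
  let ?S = "\<Sum>z\<in>roots_of_unity n. z ^ a * cnj (z ^ b)"
  \<comment> \<open>Translating the summation variable by \<open>w\<close> multiplies the sum by a factor other than 1.\<close>
  have "?S = (\<Sum>z\<in>roots_of_unity n. (w * z) ^ a * cnj ((w * z) ^ b))"
  proof (rule sum.reindex_bij_witness[where i = "\<lambda>z. w * z" and j = "\<lambda>z. cnj w * z"])
    have cancel: "w * (cnj w * z) = z" "cnj w * (w * z) = z" for z
      using ww by (simp_all add: mult.commute flip: mult.assoc)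
    show "w * (cnj w * z) = z" "cnj w * (w * z) = z" for z
      by (rule cancel)+
    show "(w * (cnj w * z)) ^ a * cnj ((w * (cnj w * z)) ^ b) = z ^ a * cnj (z ^ b)" for z
      by (simp only: cancel)
  qed (use w(1) in \<open>auto intro: roots_of_unity_mult roots_of_unity_cnj\<close>)
  also have "\<dots> = (w ^ a * cnj (w ^ b)) * ?S"
    by (simp add: sum_distrib_left power_mult_distrib mult_ac)
  finally have "?S = 0 \<or> w ^ a * cnj (w ^ b) = 1"
    by simp
  moreover have "w ^ a * cnj (w ^ b) \<noteq> 1"
  proof
    assume "w ^ a * cnj (w ^ b) = 1"
    then have "w ^ a * (w * cnj w) ^ b = w ^ b"
      by (simp add: power_mult_distrib mult_ac)
    then show False using w(2) ww by simp
  qed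
  ultimately show ?thesis using False by simp
qed

text \<open>
  Reducing an exponent modulo \<open>n\<close> does not change the power, and conjugation is inversion, so a
  negative exponent becomes a conjugate.
\<close>

lemma root_of_unity_power_diff_mod:
  assumes z: "z \<in> roots_of_unity n" and n: "n \<ge> 1"
  shows "z ^ nat ((int a - int b) mod int n) = z ^ a * cnj (z ^ b)"
proof -
  have zz: "z * cnj z = 1" using root_of_unity_mult_cnj[OF z n] .
  then have z0: "z \<noteq> 0" by auto
  have inv: "cnj z = inverse z"
    using zz by (simp add: inverse_unique)
  let ?k = "int a - int b"
  have zn: "z powi int n = 1" using z by (simp add: roots_of_unity_def)
  have "z ^ nat (?k mod int n) = z powi (?k mod int n)"
    using n by (simp add: power_int_def)
  also have "\<dots> = z powi (int n * (?k div int n)) * z powi (?k mod int n)"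
    by (simp only: power_int_mult zn) simp
  also have "\<dots> = z powi ?k"
    using z0 by (simp flip: power_int_add)
  also have "\<dots> = z ^ a * cnj (z ^ b)"
    using z0 by (simp add: power_int_diff inv field_simps)
  finally show ?thesis .
qed

section \<open>Monomials on the full design\<close>

lemma full_designD:
  "\<zeta> \<in> full_design m n \<Longrightarrow> j \<in> {1..m} \<Longrightarrow> \<zeta> j \<in> roots_of_unity (n j)"
  unfolding full_design_def by (rule PiE_mem)

lemma finite_full_design:
  "(\<And>j. j \<in> {1..m} \<Longrightarrow> n j \<ge> 1) \<Longrightarrow> finite (full_design m n)"
  unfolding full_design_def by (intro finite_PiE finite_roots_of_unity) auto

lemma finite_exponents: "finite (exponents m n)"
  unfolding exponents_def by (intro finite_PiE) auto

lemma diff_mod_in_exponents: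
  assumes "\<And>j. j \<in> {1..m} \<Longrightarrow> n j \<ge> 1"
  shows "diff_mod m n \<alpha> \<beta> \<in> exponents m n"
proof -
  have "nat ((int (\<alpha> j) - int (\<beta> j)) mod int (n j)) < n j" if "j \<in> {1..m}" for j
    using assms[OF that] by (simp add: nat_less_iff)
  then show ?thesis
    unfolding diff_mod_def exponents_def by auto
qed

lemma monomial_diff_mod:
  assumes "\<And>j. j \<in> {1..m} \<Longrightarrow> n j \<ge> 1" and "\<zeta> \<in> full_design m n"
  shows "monomial m (diff_mod m n \<alpha> \<beta>) \<zeta> = monomial m \<alpha> \<zeta> * cnj (monomial m \<beta> \<zeta>)"
  unfolding monomial_def cnj_prod prod.distrib[symmetric]
  using assms
  by (intro prod.cong refl) (simp add: diff_mod_def root_of_unity_power_diff_mod full_designD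
      del: complex_cnj_power)

lemma monomial_neg_mod:
  assumes "\<And>j. j \<in> {1..m} \<Longrightarrow> n j \<ge> 1" and "\<zeta> \<in> full_design m n"
  shows "monomial m (neg_mod m n \<alpha>) \<zeta> = cnj (monomial m \<alpha> \<zeta>)"
proof -
  have "monomial m (\<lambda>j\<in>{1..m}. 0) \<zeta> = 1"
    unfolding monomial_def by (intro prod.neutral) simp
  then show ?thesis
    unfolding neg_mod_def using monomial_diff_mod[OF assms] by simp
qed

text \<open>
  Two exponents that differ do so at some index of \<open>{1..m}\<close>, because both are extensional; the
  factor at that index vanishes.
\<close>

lemma sum_monomial_mult_cnj:
  assumes n: "\<And>j. j \<in> {1..m} \<Longrightarrow> n j \<ge> 1"
    and \<alpha>: "\<alpha> \<in> exponents m n" and \<beta>: "\<beta> \<in> exponents m n"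
  shows "(\<Sum>\<zeta>\<in>full_design m n. monomial m \<alpha> \<zeta> * cnj (monomial m \<beta> \<zeta>)) =
    (if \<alpha> = \<beta> then of_nat (\<Prod>j\<in>{1..m}. n j) else 0)"
proof -
  have "(\<Sum>\<zeta>\<in>full_design m n. monomial m \<alpha> \<zeta> * cnj (monomial m \<beta> \<zeta>)) =
      (\<Sum>\<zeta>\<in>full_design m n. \<Prod>j\<in>{1..m}. \<zeta> j ^ \<alpha> j * cnj (\<zeta> j ^ \<beta> j))"
    by (simp add: monomial_def prod.distrib)
  also have "\<dots> = (\<Prod>j\<in>{1..m}. \<Sum>z\<in>roots_of_unity (n j). z ^ \<alpha> j * cnj (z ^ \<beta> j))"
    unfolding full_design_def
    by (rule prod_sum_PiE[symmetric]) (use n finite_roots_of_unity in auto)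
  also have "\<dots> = (\<Prod>j\<in>{1..m}. if \<alpha> j = \<beta> j then of_nat (n j) else 0)"
  proof (rule prod.cong[OF refl])
    fix j assume "j \<in> {1..m}"
    then have "\<alpha> j < n j" "\<beta> j < n j"
      using \<alpha> \<beta> PiE_mem[of _ "{1..m}" "\<lambda>j. {0..<n j}" j] unfolding exponents_def by auto
    then show "(\<Sum>z\<in>roots_of_unity (n j). z ^ \<alpha> j * cnj (z ^ \<beta> j)) =
        (if \<alpha> j = \<beta> j then of_nat (n j) else 0)"
      by (rule sum_roots_of_unity_power_mult_cnj)
  qed
  also have "\<dots> = (if \<alpha> = \<beta> then of_nat (\<Prod>j\<in>{1..m}. n j) else 0)"
  proof (cases "\<alpha> = \<beta>")
    case False
    then obtain j where "j \<in> {1..m}" "\<alpha> j \<noteq> \<beta> j"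
      using \<alpha> \<beta> PiE_ext unfolding exponents_def by metis
    then have "(\<Prod>j\<in>{1..m}. if \<alpha> j = \<beta> j then of_nat (n j) else 0 :: complex) = 0"
      by (intro prod_zero) auto
    then show ?thesis using False by simp
  qed simp
  finally show ?thesis .
qed

lemma monomial_conj_point: "monomial m \<alpha> (conj_point m \<zeta>) = cnj (monomial m \<alpha> \<zeta>)"
  by (simp add: monomial_def conj_point_def)

lemma conj_point_in_full_design:
  "\<zeta> \<in> full_design m n \<Longrightarrow> conj_point m \<zeta> \<in> full_design m n"
  unfolding full_design_def conj_point_def by (auto intro: roots_of_unity_cnj)

lemma conj_point_conj_point:
  assumes "\<zeta> \<in> full_design m n"
  shows "conj_point m (conj_point m \<zeta>) = \<zeta>"
proof -
  have "\<zeta> \<in> extensional {1..m}"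
    using assms by (auto simp: full_design_def PiE_def)
  then show ?thesis
    by (intro extensionalityI[of _ "{1..m}"]) (auto simp: conj_point_def)
qed

section \<open>Coefficients as Fourier coefficients\<close>

lemma monomial_coefficients_inversion:
  assumes n: "\<And>j. j \<in> {1..m} \<Longrightarrow> n j \<ge> 1"
    and f: "monomial_coefficients m n f \<theta>" and \<beta>: "\<beta> \<in> exponents m n"
  shows "(\<Sum>\<zeta>\<in>full_design m n. f \<zeta> * cnj (monomial m \<beta> \<zeta>)) =
    of_nat (\<Prod>j\<in>{1..m}. n j) * \<theta> \<beta>"
proof -
  have "(\<Sum>\<zeta>\<in>full_design m n. f \<zeta> * cnj (monomial m \<beta> \<zeta>)) =
      (\<Sum>\<zeta>\<in>full_design m n. \<Sum>\<alpha>\<in>exponents m n.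
         \<theta> \<alpha> * (monomial m \<alpha> \<zeta> * cnj (monomial m \<beta> \<zeta>)))"
    using f unfolding monomial_coefficients_def
    by (intro sum.cong refl) (simp add: sum_distrib_right mult.assoc)
  also have "\<dots> = (\<Sum>\<alpha>\<in>exponents m n.
      \<theta> \<alpha> * (\<Sum>\<zeta>\<in>full_design m n. monomial m \<alpha> \<zeta> * cnj (monomial m \<beta> \<zeta>)))"
    by (subst sum.swap) (simp add: sum_distrib_left)
  also have "\<dots> = (\<Sum>\<alpha>\<in>exponents m n.
      if \<alpha> = \<beta> then of_nat (\<Prod>j\<in>{1..m}. n j) * \<theta> \<beta> else 0)"
    by (rule sum.cong[OF refl], subst sum_monomial_mult_cnj[OF n _ \<beta>]) auto
  also have "\<dots> = of_nat (\<Prod>j\<in>{1..m}. n j) * \<theta> \<beta>"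
    using \<beta> finite_exponents[of m n] by simp
  finally show ?thesis .
qed

lemma sum_mset_eq_sum_count:
  fixes f :: "'a \<Rightarrow> 'b::comm_semiring_1"
  assumes "finite A" "set_mset F \<subseteq> A"
  shows "(\<Sum>x\<in>#F. f x) = (\<Sum>x\<in>A. of_nat (count F x) * f x)"
  using assms(2)
proof (induction F)
  case (add x F)
  have "(\<Sum>y\<in>A. of_nat (count (add_mset x F) y) * f y) =
      (\<Sum>y\<in>A. (if y = x then f y else 0) + of_nat (count F y) * f y)"
    by (intro sum.cong refl) (simp add: algebra_simps)
  also have "\<dots> = f x + (\<Sum>y\<in>A. of_nat (count F y) * f y)"
    using add.prems assms(1) by (simp add: sum.distrib)
  finally show ?case using add by simp
qed simp

lemma mean_value_cong:
  "(\<And>\<zeta>. \<zeta> \<in># F \<Longrightarrow> f \<zeta> = g \<zeta>) \<Longrightarrow> mean_value F f = mean_value F g"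
  unfolding mean_value_def by (metis image_mset_cong)

lemma mean_value_cnj: "mean_value F (\<lambda>\<zeta>. cnj (f \<zeta>)) = cnj (mean_value F f)"
proof -
  have "(\<Sum>\<zeta>\<in>#F. cnj (f \<zeta>)) = cnj (\<Sum>\<zeta>\<in>#F. f \<zeta>)"
    by (induction F) simp_all
  then show ?thesis by (simp add: mean_value_def)
qed

lemma orthogonal_on_commute: "orthogonal_on F f g \<longleftrightarrow> orthogonal_on F g f"
  unfolding orthogonal_on_def
  using mean_value_cnj[of F "\<lambda>\<zeta>. f \<zeta> * cnj (g \<zeta>)"] by (simp add: mult.commute)

text \<open>
  The inversion formula has the conjugate of the monomial where the mean has the monomial itself.
  Since multiplicities are real, this conjugates the coefficient.
\<close>

lemma mean_value_monomial:
  assumes n: "\<And>j. j \<in> {1..m} \<Longrightarrow> n j \<ge> 1" and F: "is_fraction m n F"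
    and b: "monomial_coefficients m n (\<lambda>\<zeta>. of_nat (count F \<zeta>)) b" and \<alpha>: "\<alpha> \<in> exponents m n"
  shows "mean_value F (monomial m \<alpha>) =
    of_nat (\<Prod>j\<in>{1..m}. n j) * cnj (b \<alpha>) / of_nat (size F)"
proof -
  have "(\<Sum>\<zeta>\<in>#F. monomial m \<alpha> \<zeta>) =
      (\<Sum>\<zeta>\<in>full_design m n. of_nat (count F \<zeta>) * monomial m \<alpha> \<zeta>)"
    using F n by (intro sum_mset_eq_sum_count finite_full_design) (auto simp: is_fraction_def)
  also have "\<dots> = cnj (\<Sum>\<zeta>\<in>full_design m n. of_nat (count F \<zeta>) * cnj (monomial m \<alpha> \<zeta>))"
    by simp
  also have "\<dots> = of_nat (\<Prod>j\<in>{1..m}. n j) * cnj (b \<alpha>)"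
    by (subst monomial_coefficients_inversion[OF n b \<alpha>]) simp_all
  finally show ?thesis by (simp add: mean_value_def)
qed

lemma centered_on_monomial_iff:
  assumes "\<And>j. j \<in> {1..m} \<Longrightarrow> n j \<ge> 1" and "is_fraction m n F" and "F \<noteq> {#}"
    and "monomial_coefficients m n (\<lambda>\<zeta>. of_nat (count F \<zeta>)) b" and "\<alpha> \<in> exponents m n"
  shows "centered_on F (monomial m \<alpha>) \<longleftrightarrow> b \<alpha> = 0"
proof -
  have "(\<Prod>j\<in>{1..m}. n j) \<noteq> 0" using assms(1) by fastforce
  moreover have "size F \<noteq> 0" using assms(3) by simp
  moreover have "mean_value F (monomial m \<alpha>) =
      of_nat (\<Prod>j\<in>{1..m}. n j) * cnj (b \<alpha>) / of_nat (size F)"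
    using assms by (intro mean_value_monomial)
  ultimately show ?thesis
    unfolding centered_on_def
    by (simp only: divide_eq_0_iff mult_eq_0_iff of_nat_eq_0_iff complex_cnj_zero_iff simp_thms)
qed

lemma orthogonal_on_monomial_iff_centered_on:
  assumes "\<And>j. j \<in> {1..m} \<Longrightarrow> n j \<ge> 1" and "is_fraction m n F"
  shows "orthogonal_on F (monomial m \<alpha>) (monomial m \<beta>) \<longleftrightarrow>
    centered_on F (monomial m (diff_mod m n \<alpha> \<beta>))"
proof -
  have "mean_value F (\<lambda>\<zeta>. monomial m \<alpha> \<zeta> * cnj (monomial m \<beta> \<zeta>)) =
      mean_value F (monomial m (diff_mod m n \<alpha> \<beta>))"
    using assms(2)
    by (intro mean_value_cong monomial_diff_mod[symmetric] assms(1)) (auto simp: is_fraction_def)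
  then show ?thesis by (simp add: orthogonal_on_def centered_on_def)
qed

lemma centered_on_monomial_neg_mod:
  assumes "\<And>j. j \<in> {1..m} \<Longrightarrow> n j \<ge> 1" and "is_fraction m n F"
  shows "centered_on F (monomial m (neg_mod m n \<alpha>)) \<longleftrightarrow> centered_on F (monomial m \<alpha>)"
proof -
  have "mean_value F (monomial m (neg_mod m n \<alpha>)) = mean_value F (\<lambda>\<zeta>. cnj (monomial m \<alpha> \<zeta>))"
    using assms(2)
    by (intro mean_value_cong monomial_neg_mod assms(1)) (auto simp: is_fraction_def)
  then show ?thesis by (simp add: centered_on_def mean_value_cnj)
qed

lemma self_conjugate_iff_real_coefficients:
  assumes n: "\<And>j. j \<in> {1..m} \<Longrightarrow> n j \<ge> 1"
    and b: "monomial_coefficients m n (\<lambda>\<zeta>. of_nat (count F \<zeta>)) b"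
  shows "self_conjugate m n F \<longleftrightarrow> (\<forall>\<alpha>\<in>exponents m n. b \<alpha> \<in> \<real>)"
proof
  let ?D = "full_design m n" and ?N = "of_nat (\<Prod>j\<in>{1..m}. n j) :: complex"
  assume sc: "self_conjugate m n F"
  show "\<forall>\<alpha>\<in>exponents m n. b \<alpha> \<in> \<real>"
  proof
    fix \<alpha> assume \<alpha>: "\<alpha> \<in> exponents m n"
    note inversion = monomial_coefficients_inversion[OF n b \<alpha>]
    have "?N * b \<alpha> = (\<Sum>\<zeta>\<in>?D. of_nat (count F \<zeta>) * cnj (monomial m \<alpha> \<zeta>))"
      by (simp only: inversion)
    also have "\<dots> = (\<Sum>\<zeta>\<in>?D. of_nat (count F \<zeta>) * monomial m \<alpha> \<zeta>)"
      by (rule sum.reindex_bij_witness[where i = "conj_point m" and j = "conj_point m"])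
        (use sc in \<open>auto simp: self_conjugate_def monomial_conj_point conj_point_conj_point
          intro: conj_point_in_full_design\<close>)
    also have "\<dots> = cnj (\<Sum>\<zeta>\<in>?D. of_nat (count F \<zeta>) * cnj (monomial m \<alpha> \<zeta>))"
      by simp
    also have "\<dots> = ?N * cnj (b \<alpha>)"
      by (subst inversion) simp_all
    finally have "?N * b \<alpha> = ?N * cnj (b \<alpha>)" .
    moreover have "(\<Prod>j\<in>{1..m}. n j) \<noteq> 0" using n by fastforce
    ultimately have "cnj (b \<alpha>) = b \<alpha>"
      by (metis mult_cancel_left of_nat_eq_0_iff)
    then show "b \<alpha> \<in> \<real>" by (simp add: Reals_cnj_iff)
  qed
next
  assume real: "\<forall>\<alpha>\<in>exponents m n. b \<alpha> \<in> \<real>"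
  have expansion: "of_nat (count F \<zeta>) = (\<Sum>\<alpha>\<in>exponents m n. b \<alpha> * monomial m \<alpha> \<zeta>)"
    if "\<zeta> \<in> full_design m n" for \<zeta>
    using b that by (simp add: monomial_coefficients_def)
  show "self_conjugate m n F"
    unfolding self_conjugate_def
  proof
    fix \<zeta> assume \<zeta>: "\<zeta> \<in> full_design m n"
    have "of_nat (count F (conj_point m \<zeta>)) =
        (\<Sum>\<alpha>\<in>exponents m n. b \<alpha> * cnj (monomial m \<alpha> \<zeta>))"
      using expansion[OF conj_point_in_full_design[OF \<zeta>]] by (simp add: monomial_conj_point)
    also have "\<dots> = cnj (\<Sum>\<alpha>\<in>exponents m n. b \<alpha> * monomial m \<alpha> \<zeta>)"
      unfolding cnj_sum using real by (intro sum.cong refl) (simp add: Reals_cnj_iff)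
    also have "\<dots> = of_nat (count F \<zeta>)"
      by (simp flip: expansion[OF \<zeta>])
    finally show "count F \<zeta> = count F (conj_point m \<zeta>)" by simp
  qed
qed

section \<open>Centering, orthogonality and self-conjugacy of a fraction\<close>

theorem proposition2:
  fixes m :: nat and n :: "nat \<Rightarrow> nat"
    and F :: "(nat \<Rightarrow> complex) multiset"
    and b :: "(nat \<Rightarrow> nat) \<Rightarrow> complex"
  assumes "m \<ge> 1"
    and "\<And>j. j \<in> {1..m} \<Longrightarrow> n j \<ge> 1"
    and "is_fraction m n F"
    and "F \<noteq> {#}"
    and "monomial_coefficients m n (\<lambda>\<zeta>. of_nat (count F \<zeta>)) b"
  shows
    "(\<forall>\<alpha>\<in>exponents m n.
        centered_on F (monomial m \<alpha>) \<longleftrightarrow> b \<alpha> = 0 \<and> b (neg_mod m n \<alpha>) = 0) \<and>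
     (\<forall>\<alpha>\<in>exponents m n. \<forall>\<beta>\<in>exponents m n.
        orthogonal_on F (monomial m \<alpha>) (monomial m \<beta>) \<longleftrightarrow> b (diff_mod m n \<alpha> \<beta>) = 0) \<and>
     (\<forall>\<alpha>\<in>exponents m n. centered_on F (monomial m \<alpha>) \<longrightarrow>
        (\<forall>\<beta>\<in>exponents m n. \<forall>\<gamma>\<in>exponents m n.
           \<alpha> = diff_mod m n \<beta> \<gamma> \<or> \<alpha> = diff_mod m n \<gamma> \<beta> \<longrightarrow>
           orthogonal_on F (monomial m \<beta>) (monomial m \<gamma>))) \<and>
     (self_conjugate m n F \<longleftrightarrow> (\<forall>\<alpha>\<in>exponents m n. b \<alpha> \<in> \<real>))"
proof (intro conjI ballI impI)
  have exponent: "diff_mod m n \<alpha> \<beta> \<in> exponents m n" for \<alpha> \<beta>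
    using assms(2) by (rule diff_mod_in_exponents)
  have centered_iff: "centered_on F (monomial m \<alpha>) \<longleftrightarrow> b \<alpha> = 0" if "\<alpha> \<in> exponents m n" for \<alpha>
    using assms(2-5) that by (rule centered_on_monomial_iff)
  have orthogonal_iff: "orthogonal_on F (monomial m \<alpha>) (monomial m \<beta>) \<longleftrightarrow>
      centered_on F (monomial m (diff_mod m n \<alpha> \<beta>))" for \<alpha> \<beta>
    using assms(2,3) by (rule orthogonal_on_monomial_iff_centered_on)
  fix \<alpha> assume \<alpha>: "\<alpha> \<in> exponents m n"
  have "neg_mod m n \<alpha> \<in> exponents m n"
    unfolding neg_mod_def by (rule exponent)
  moreover have "centered_on F (monomial m (neg_mod m n \<alpha>)) \<longleftrightarrow> centered_on F (monomial m \<alpha>)"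
    using assms(2,3) by (rule centered_on_monomial_neg_mod)
  ultimately show "centered_on F (monomial m \<alpha>) \<longleftrightarrow> b \<alpha> = 0 \<and> b (neg_mod m n \<alpha>) = 0"
    using centered_iff \<alpha> by blast
  show "orthogonal_on F (monomial m \<alpha>) (monomial m \<beta>) \<longleftrightarrow> b (diff_mod m n \<alpha> \<beta>) = 0" for \<beta>
    unfolding orthogonal_iff by (rule centered_iff[OF exponent])
  show "orthogonal_on F (monomial m \<beta>) (monomial m \<gamma>)"
    if "centered_on F (monomial m \<alpha>)" "\<alpha> = diff_mod m n \<beta> \<gamma> \<or> \<alpha> = diff_mod m n \<gamma> \<beta>" for \<beta> \<gamma>
    using that orthogonal_iff orthogonal_on_commute by blast
next
  show "self_conjugate m n F \<longleftrightarrow> (\<forall>\<alpha>\<in>exponents m n. b \<alpha> \<in> \<real>)"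
    using assms(2,5) by (rule self_conjugate_iff_real_coefficients)
qed

end
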